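(* Let $k\ge 1$. No deterministic online algorithm for unweighted any-order interval selection with revocable decisions achieves a competitive ratio better than $2k$ on instances with at most $k$ distinct interval lengths: for every deterministic online algorithm $A$ there is an instance with at most $k$ distinct interval lengths, together with an arrival order, such that $\mathrm{OPT}\ge 2k\cdot\mathrm{ALG}$.
   Context: Intervals are half-open $[s_i,f_i)$ with $s_i<f_i$ real; two intervals conflict if they intersect. Intervals arrive online one at a time in an order chosen by an adversary. On each arrival the algorithm decides immediately, maintaining at all times a set of pairwise non-conflicting intervals; it may accept the new interval while discarding any currently held intervals that conflict with it (revoking), and a discarded or rejected interval can never be taken again. $\mathrm{ALG}$ is the number of intervals in the algorithm's final solution, $\mathrm{OPT}$ the maximum number of pairwise non-conflicting intervals in the instance; the competitive ratio is $\mathrm{OPT}/\mathrm{ALG}$ with no additive constant. *)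

theory Defs
  imports Complex_Main
begin

(* The pair (s, f) stands for the half-open interval [s, f). *)
type_synonym interval = "real \<times> real"

definition ivl :: "interval \<Rightarrow> real set" where
  "ivl I = {fst I ..< snd I}"

definition ivl_length :: "interval \<Rightarrow> real" where
  "ivl_length I = snd I - fst I"

definition conflict :: "interval \<Rightarrow> interval \<Rightarrow> bool" where
  "conflict I J \<longleftrightarrow> ivl I \<inter> ivl J \<noteq> {}"

definition conflict_free :: "interval set \<Rightarrow> bool" where
  "conflict_free S \<longleftrightarrow> pairwise (\<lambda>I J. \<not> conflict I J) S"

(* An instance together with its arrival order: a list without repetitions,
   earliest arrival first. *)
definition is_instance :: "interval list \<Rightarrow> bool" where
  "is_instance xs \<longleftrightarrow> distinct xs \<and> (\<forall>I \<in> set xs. fst I < snd I)"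

definition num_lengths :: "interval list \<Rightarrow> nat" where
  "num_lengths xs = card (ivl_length ` set xs)"

(* A deterministic online algorithm sees the earlier arrivals (earliest first) and the
   new interval, and returns True to accept it, False to reject it.  Its own earlier
   decisions, and hence the intervals it currently holds, are determined by the
   earlier arrivals, so they need not be passed separately. *)
type_synonym online_algorithm = "interval list \<Rightarrow> interval \<Rightarrow> bool"

(* Here the list of arrivals has the most recent one at its head. *)
primrec held_rev :: "online_algorithm \<Rightarrow> interval list \<Rightarrow> interval set" where
  "held_rev A [] = {}"
| "held_rev A (I # past) =
     (if A (rev past) I
      then insert I {J \<in> held_rev A past. \<not> conflict J I}
      else held_rev A past)"

definition held :: "online_algorithm \<Rightarrow> interval list \<Rightarrow> interval set" where
  "held A xs = held_rev A (rev xs)"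

lemma held_Nil [simp]: "held A [] = {}"
  by (simp add: held_def)

lemma held_snoc:
  "held A (xs @ [I]) =
     (if A xs I then insert I {J \<in> held A xs. \<not> conflict J I} else held A xs)"
  by (simp add: held_def)

lemma held_subset: "held A xs \<subseteq> set xs"
  by (induction xs rule: rev_induct) (auto simp: held_snoc)

lemma held_conflict_free: "conflict_free (held A xs)"
  by (induction xs rule: rev_induct)
     (auto simp: held_snoc conflict_free_def pairwise_def conflict_def Int_commute)

definition ALG :: "online_algorithm \<Rightarrow> interval list \<Rightarrow> nat" where
  "ALG A xs = card (held A xs)"

definition OPT :: "interval list \<Rightarrow> nat" where
  "OPT xs = Max (card ` {S. S \<subseteq> set xs \<and> conflict_free S})"

(* The ratio OPT / ALG is bounded by c on all instances with at most k distinct lengths,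
   without additive constant; written multiplicatively, so that ALG = 0 < OPT counts as
   an infinite ratio. *)
definition competitive :: "nat \<Rightarrow> real \<Rightarrow> online_algorithm \<Rightarrow> bool" where
  "competitive k c A \<longleftrightarrow>
     (\<forall>xs. is_instance xs \<and> num_lengths xs \<le> k \<longrightarrow> real (OPT xs) \<le> c * real (ALG A xs))"

end

(* The adversary keeps the algorithm down to a single held interval while confining all further
   arrivals to a region inside it.  In this region it lays out equally long intervals
   in a row, each overlapping only its two neighbours, and presents them one after the other.
   If the algorithm ever keeps one of them while both its neighbours have been presented, then the
   two neighbours are lost, and the part of the kept interval between them is a new region for
   a shorter length; so each length contributes two to OPT.  Otherwise
   the algorithm accepts only to move along the row, still holding at most one interval,
   and every second interval of a long row is already a good enough solution. *)
theory Submission imports Defs begin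

lemma OPT_ge_card:
  assumes "S \<subseteq> set xs" "conflict_free S"
  shows "card S \<le> OPT xs"
proof -
  have "finite {S. S \<subseteq> set xs \<and> conflict_free S}"
    by (rule finite_subset[of _ "Pow (set xs)"]) auto
  then show ?thesis
    unfolding OPT_def using assms by (intro Max_ge) auto
qed

lemma conflict_sym: "conflict I J \<longleftrightarrow> conflict J I"
  by (auto simp: conflict_def)

section \<open>Presenting a row of overlapping intervals\<close>

text \<open>Each newcomer conflicts with everything held, with \<open>J n\<close> by
  \<open>nbr\<close> and with older intervals by \<open>outer\<close>, so once accepted it is held
  alone. The second disjunct is the adversary's gain: \<open>1 \<le> m\<close> secures the left
  neighbour of \<open>J m\<close>, \<open>Suc m\<close> the right one.\<close>

lemma row_walk:
  fixes J :: "nat \<Rightarrow> interval"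
  assumes inj: "inj J" and fresh: "range J \<inter> set xs = {}"
    and nbr: "\<And>n. conflict (J n) (J (Suc n))"
    and outer: "\<And>n H. n \<le> N \<Longrightarrow> H \<in> held A xs \<Longrightarrow> conflict H (J n)"
    and start: "distinct (xs @ ys0)" "set ys0 = J ` {..1}"
      "held A (xs @ ys0) = {J 1} \<or> held A (xs @ ys0) = held A xs"
    and "1 \<le> n" "n \<le> N"
  shows "(\<exists>ys. distinct (xs @ ys) \<and> set ys = J ` {..n} \<and>
            (held A (xs @ ys) = {J n} \<or> held A (xs @ ys) = held A xs)) \<or>
         (\<exists>m ys. 1 \<le> m \<and> m < n \<and> distinct (xs @ ys) \<and> set ys = J ` {..Suc m} \<and>
            held A (xs @ ys) = {J m})"
  using \<open>1 \<le> n\<close> \<open>n \<le> N\<close>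
proof (induction n rule: dec_induct)
  case base
  then show ?case using start by blast
next
  case (step n)
  then consider
    (walk) ys where "distinct (xs @ ys)" "set ys = J ` {..n}"
       "held A (xs @ ys) = {J n} \<or> held A (xs @ ys) = held A xs"
  | (stuck) m ys where "1 \<le> m" "m < n" "distinct (xs @ ys)" "set ys = J ` {..Suc m}"
       "held A (xs @ ys) = {J m}"
    by auto
  then show ?case
  proof cases
    case stuck
    then show ?thesis using less_SucI by blast
  next
    case walk
    let ?ys = "ys @ [J (Suc n)]"
    have "J (Suc n) \<notin> set ys"
      using walk(2) inj by (auto dest: injD)
    then have dist: "distinct (xs @ ?ys)"
      using walk(1) fresh by auto
    have set: "set ?ys = J ` {..Suc n}"
      using walk(2) by (simp add: atMost_Suc)
    have snoc: "held A (xs @ ?ys) = (if A (xs @ ys) (J (Suc n))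
        then insert (J (Suc n)) {H \<in> held A (xs @ ys). \<not> conflict H (J (Suc n))}
        else held A (xs @ ys))"
      using held_snoc[of A "xs @ ys"] by simp
    show ?thesis
    proof (cases "A (xs @ ys) (J (Suc n))")
      case True
      have "held A (xs @ ?ys) = {J (Suc n)}"
        using walk(3) nbr[of n] outer[OF step.prems] True unfolding snoc by auto
      then show ?thesis using dist set by blast
    next
      case False
      then have "held A (xs @ ?ys) = held A (xs @ ys)"
        unfolding snoc by simp
      \<comment> \<open>If \<open>J n\<close> was held, this is the second disjunct with
        \<open>m = n\<close>; if \<open>held A xs\<close> was held, nothing changed and the walk
        goes on.\<close>
      then show ?thesis using walk(3) dist set step.hyps by (metis lessI)
    qed
  qed
qed

text \<open>If the very first interval \<open>G 0\<close> is kept when \<open>G 1\<close> arrives, the walk turns round and goes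
  left, with \<open>G 1\<close> as the lost neighbour.\<close>

lemma row_walk_both_ways:
  fixes G :: "int \<Rightarrow> interval"
  assumes dist: "distinct xs" and inj: "inj G" and fresh: "range G \<inter> set xs = {}"
    and nbr: "\<And>i. conflict (G i) (G (i + 1))"
    and outer: "\<And>i H. - int N \<le> i \<Longrightarrow> i \<le> int N \<Longrightarrow> H \<in> held A xs \<Longrightarrow> conflict H (G i)"
    and "1 \<le> N"
  obtains (lost) i ys where "\<bar>i\<bar> \<le> int N" "distinct (xs @ ys)" "set ys \<subseteq> range G"
      "G (i - 1) \<in> set ys" "G (i + 1) \<in> set ys" "held A (xs @ ys) = {G i}"
  | (long) i ys where "distinct (xs @ ys)" "set ys \<subseteq> range G"
      "G ` {i..i + int N} \<subseteq> set ys"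
      "(\<exists>j. held A (xs @ ys) = {G j}) \<or> held A (xs @ ys) = held A xs"
proof -
  let ?ys0 = "[G 0, G 1]"
  have ne: "G 0 \<noteq> G 1" using inj by (auto dest: injD)
  have dist0: "distinct (xs @ ?ys0)" using dist ne fresh by auto
  have G01: "conflict (G 0) (G 1)" using nbr[of 0] by simp
  have snoc0: "held A (xs @ [G 0]) = (if A xs (G 0) then {G 0} else held A xs)"
    using outer[of 0] unfolding held_snoc by auto
  have snoc1: "held A (xs @ ?ys0) = (if A (xs @ [G 0]) (G 1)
        then insert (G 1) {H \<in> held A (xs @ [G 0]). \<not> conflict H (G 1)}
        else held A (xs @ [G 0]))"
    using held_snoc[of A "xs @ [G 0]"] by simp
  have outer1: "conflict H (G 1)" if "H \<in> held A xs" for H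
    using outer[OF _ _ that, of 1] \<open>1 \<le> N\<close> by simp
  \<comment> \<open>\<open>G 0\<close> and \<open>G 1\<close> conflict, so at most one of them
    survives; no acceptance at all is treated like a walk to the right.\<close>
  consider (right) "held A (xs @ ?ys0) = {G 1} \<or> held A (xs @ ?ys0) = held A xs"
    | (left) "held A (xs @ ?ys0) = {G 0}"
  proof (cases "A (xs @ [G 0]) (G 1)")
    case True
    then have "held A (xs @ ?ys0) = {G 1}"
      unfolding snoc1 snoc0 using G01 outer1 by auto
    then show thesis using right by blast
  next
    case False
    then show thesis using right left snoc0 snoc1 by (cases "A xs (G 0)") auto
  qed
  then show thesis
  proof cases
    case right
    define J where "J n = G (int n)" for n
    have J: "inj J" "range J \<inter> set xs = {}" "set ?ys0 = J ` {..1}"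
      "range J \<subseteq> range G" "J 1 = G 1"
      using fresh inj_eq[OF inj] by (auto simp: J_def inj_def atMost_Suc)
    have J_nbr: "conflict (J n) (J (Suc n))" for n
      using nbr[of "int n"] by (simp add: J_def add.commute)
    have J_outer: "conflict H (J n)" if "n \<le> N" "H \<in> held A xs" for n H
      using outer[OF _ _ that(2)] that(1) by (simp add: J_def)
    have "held A (xs @ ?ys0) = {J 1} \<or> held A (xs @ ?ys0) = held A xs"
      using right J(5) by simp
    from row_walk[OF J(1,2) J_nbr J_outer dist0 J(3) this \<open>1 \<le> N\<close> order_refl] consider
      (walk) ys where "distinct (xs @ ys)" "set ys = J ` {..N}"
        "held A (xs @ ys) = {J N} \<or> held A (xs @ ys) = held A xs"
    | (stuck) m ys where "1 \<le> m" "m < N" "distinct (xs @ ys)" "set ys = J ` {..Suc m}"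
        "held A (xs @ ys) = {J m}"
      by auto
    then show thesis
    proof cases
      case walk
      have "G ` {0..0 + int N} \<subseteq> set ys"
      proof
        fix I assume "I \<in> G ` {0..0 + int N}"
        then obtain i where "I = G i" "0 \<le> i" "i \<le> int N" by auto
        then have "I = J (nat i)" "nat i \<le> N" by (auto simp: J_def)
        then show "I \<in> set ys" using walk(2) by auto
      qed
      moreover have "set ys \<subseteq> range G" using walk(2) J(4) by auto
      ultimately show thesis using long walk(1,3) J_def by metis
    next
      case stuck
      have "J (m - 1) \<in> set ys" "J (m + 1) \<in> set ys" using stuck(4) by auto
      then have "G (int m - 1) \<in> set ys" "G (int m + 1) \<in> set ys"
        using stuck(1) by (auto simp: J_def of_nat_diff add.commute)
      moreover have "set ys \<subseteq> range G" using stuck(4) J(4) by auto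
      ultimately show thesis
        using stuck lost[of "int m" ys] by (simp add: J_def)
    qed
  next
    case left
    \<comment> \<open>The reflection swaps \<open>G 0\<close> and \<open>G 1\<close>, so the same
      two opening arrivals also begin a walk to the left, now standing at
      \<open>J 1 = G 0\<close>.\<close>
    define J where "J n = G (1 - int n)" for n
    have J: "inj J" "range J \<inter> set xs = {}" "set ?ys0 = J ` {..1}"
      "range J \<subseteq> range G" "J 1 = G 0"
      using fresh inj_eq[OF inj] by (auto simp: J_def inj_def atMost_Suc)
    have J_nbr: "conflict (J n) (J (Suc n))" for n
      using nbr[of "- int n"] by (simp add: J_def conflict_sym add.commute)
    have J_outer: "conflict H (J n)" if "n \<le> N" "H \<in> held A xs" for n H
      using outer[OF _ _ that(2)] that(1) \<open>1 \<le> N\<close> by (simp add: J_def)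
    have "held A (xs @ ?ys0) = {J 1} \<or> held A (xs @ ?ys0) = held A xs"
      using left J(5) by simp
    from row_walk[OF J(1,2) J_nbr J_outer dist0 J(3) this \<open>1 \<le> N\<close> order_refl] consider
      (walk) ys where "distinct (xs @ ys)" "set ys = J ` {..N}"
        "held A (xs @ ys) = {J N} \<or> held A (xs @ ys) = held A xs"
    | (stuck) m ys where "1 \<le> m" "m < N" "distinct (xs @ ys)" "set ys = J ` {..Suc m}"
        "held A (xs @ ys) = {J m}"
      by auto
    then show thesis
    proof cases
      case walk
      have "G ` {1 - int N..1 - int N + int N} \<subseteq> set ys"
      proof
        fix I assume "I \<in> G ` {1 - int N..1 - int N + int N}"
        then obtain i where "I = G i" "1 - int N \<le> i" "i \<le> 1" by auto
        then have "I = J (nat (1 - i))" "nat (1 - i) \<le> N" by (auto simp: J_def)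
        then show "I \<in> set ys" using walk(2) by auto
      qed
      moreover have "set ys \<subseteq> range G" using walk(2) J(4) by auto
      ultimately show thesis using long walk(1,3) J_def by metis
    next
      case stuck
      have "J (m - 1) \<in> set ys" "J (m + 1) \<in> set ys" using stuck(4) by auto
      then have "G (1 - int m - 1) \<in> set ys" "G (1 - int m + 1) \<in> set ys"
        using stuck(1) by (auto simp: J_def of_nat_diff algebra_simps)
      moreover have "set ys \<subseteq> range G" using stuck(4) J(4) by auto
      ultimately show thesis
        using stuck lost[of "1 - int m" ys] by (simp add: J_def)
    qed
  qed
qed

section \<open>One round: passing to a shorter length\<close>

text \<open>The invariant after \<open>j\<close> rounds. \<open>S\<close> is the solution secured so
  far; as it avoids the region, it can be joined with anything placed there. An interval inside the
  region is shorter than all earlier ones, hence never a repetition. An upper bound on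
  \<open>ALG\<close> instead of equality admits the empty start.\<close>

definition cornered :: "online_algorithm \<Rightarrow> nat \<Rightarrow> interval list \<Rightarrow> real \<Rightarrow> real \<Rightarrow> bool" where
  "cornered A j xs a b \<longleftrightarrow>
     is_instance xs \<and> num_lengths xs \<le> j \<and> a < b \<and>
     (\<forall>I \<in> set xs. b - a < ivl_length I) \<and>
     ALG A xs \<le> 1 \<and> (\<forall>H \<in> held A xs. {a..<b} \<subseteq> ivl H) \<and>
     (\<exists>S \<subseteq> set xs. conflict_free S \<and> card S = 2 * j \<and> (\<forall>I \<in> S. ivl I \<inter> {a..<b} = {}))"

text \<open>A row of one new length is placed in the region. Either a held interval has both
  neighbours presented, and these two join \<open>S\<close>, or a long row yields \<open>n\<close>
  disjoint intervals against at most one held.\<close>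

lemma cornered_step:
  assumes "cornered A j xs a b" "1 \<le> n"
  shows "(\<exists>xs a b. cornered A (Suc j) xs a b) \<or>
         (\<exists>xs. is_instance xs \<and> num_lengths xs \<le> Suc j \<and> ALG A xs \<le> 1 \<and> n \<le> OPT xs)"
proof -
  from assms(1) obtain S where inst: "is_instance xs" and lens: "num_lengths xs \<le> j"
    and "a < b" and larger: "\<And>I. I \<in> set xs \<Longrightarrow> b - a < ivl_length I"
    and single: "ALG A xs \<le> 1" and outer: "\<And>H. H \<in> held A xs \<Longrightarrow> {a..<b} \<subseteq> ivl H"
    and S: "S \<subseteq> set xs" "conflict_free S" "card S = 2 * j"
      "\<And>I. I \<in> S \<Longrightarrow> ivl I \<inter> {a..<b} = {}"
    unfolding cornered_def by blast
  \<comment> \<open>A completed walk presents \<open>N + 1\<close> consecutive intervals, so every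
    second one gives at least \<open>n\<close>.\<close>
  define N where "N = 2 * n"
  define c where "c = (a + b) / 2"
  \<comment> \<open>With length \<open>4 * u\<close> and stride \<open>3 * u\<close>, neighbours
    overlap by \<open>u\<close>, second neighbours have a gap of \<open>2 * u\<close>, and each
    interval keeps a middle of length \<open>2 * u\<close> outside both neighbours. The divisor 20
    leaves room: indices up to \<open>N + 1\<close> on either side of the centre \<open>c\<close>
    reach at most \<open>3 * u * N + 7 * u\<close> from it, and the region reaches
    \<open>10 * u * N\<close>.\<close>
  define u where "u = (b - a) / real (20 * N)"
  define G :: "int \<Rightarrow> interval" where
    "G i = (c + 3 * u * of_int i, c + 3 * u * of_int i + 4 * u)" for i
  have "1 \<le> N" using \<open>1 \<le> n\<close> by (simp add: N_def)
  have "0 < u" using \<open>a < b\<close> \<open>1 \<le> N\<close> by (simp add: u_def)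
  have "b - a = 20 * (u * real N)"
    using \<open>1 \<le> N\<close> by (simp add: u_def)
  then have a: "a = c - 10 * (u * real N)" and b: "b = c + 10 * (u * real N)"
    by (simp_all add: c_def field_simps)
  have uN: "2 * u \<le> u * real N" using \<open>0 < u\<close> \<open>1 \<le> n\<close> by (simp add: N_def)
  have len: "ivl_length (G i) = 4 * u" for i
    by (simp add: G_def ivl_length_def)
  have inj: "inj G"
    using \<open>0 < u\<close> by (auto simp: inj_def G_def)
  have fresh: "range G \<inter> set xs = {}"
    using larger uN len \<open>b - a = _\<close> \<open>0 < u\<close> by fastforce
  have nbr: "conflict (G i) (G (i + 1))" for i
  proof -
    have "c + 3 * u * of_int i + 3 * u \<in> ivl (G i) \<inter> ivl (G (i + 1))"
      using \<open>0 < u\<close> by (simp add: G_def ivl_def algebra_simps)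
    then show ?thesis unfolding conflict_def by blast
  qed
  have apart: "\<not> conflict (G i) (G i')" if "i + 2 \<le> i'" for i i'
  proof -
    have "u * (of_int i + 2) \<le> u * of_int i'"
      using that \<open>0 < u\<close> by (intro mult_left_mono) linarith+
    then show ?thesis
      using \<open>0 < u\<close> by (auto simp: conflict_def G_def ivl_def algebra_simps)
  qed
  \<comment> \<open>The bound is \<open>N + 1\<close> because the neighbours of an interval with
    index up to \<open>N\<close> must also fit.\<close>
  have inside: "ivl (G i) \<subseteq> {a..<b}" if "\<bar>i\<bar> \<le> int N + 1" for i
  proof -
    have "\<bar>of_int i :: real\<bar> \<le> real N + 1" using that by linarith
    then have "u * \<bar>of_int i\<bar> \<le> u * (real N + 1)"
      using \<open>0 < u\<close> by (intro mult_left_mono) auto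
    moreover have "\<bar>u * of_int i\<bar> = u * \<bar>of_int i\<bar>"
      using \<open>0 < u\<close> by (simp add: abs_mult)
    ultimately have bound: "\<bar>u * of_int i\<bar> \<le> u * real N + u" by (simp add: algebra_simps)
    have "G i = (c + 3 * (u * of_int i), c + 3 * (u * of_int i) + 4 * u)"
      by (simp add: G_def)
    moreover have "a \<le> c + 3 * (u * of_int i)" "c + 3 * (u * of_int i) + 4 * u \<le> b"
      using bound uN \<open>0 < u\<close> unfolding a b by linarith+
    ultimately show ?thesis by (simp add: ivl_def)
  qed
  have nonempty: "ivl (G i) \<noteq> {}" for i
    using \<open>0 < u\<close> by (simp add: G_def ivl_def)
  have outer_conflict: "conflict H (G i)"
    if "- int N \<le> i" "i \<le> int N" "H \<in> held A xs" for i H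
    using inside[of i] outer[OF that(3)] nonempty[of i] that(1,2)
    unfolding conflict_def by fastforce
  have inst': "is_instance (xs @ ys)" and lens': "num_lengths (xs @ ys) \<le> Suc j"
    if "distinct (xs @ ys)" "set ys \<subseteq> range G" for ys
  proof -
    show "is_instance (xs @ ys)"
      using inst that \<open>0 < u\<close> unfolding is_instance_def by (auto simp: G_def)
    have "ivl_length ` set (xs @ ys) \<subseteq> insert (4 * u) (ivl_length ` set xs)"
      using that(2) len by auto
    then have "num_lengths (xs @ ys) \<le> card (insert (4 * u) (ivl_length ` set xs))"
      unfolding num_lengths_def by (intro card_mono) auto
    also have "\<dots> \<le> Suc (num_lengths xs)"
      unfolding num_lengths_def by (simp add: card_insert_if)
    finally show "num_lengths (xs @ ys) \<le> Suc j" using lens by simp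
  qed
  have dist: "distinct xs" using inst by (simp add: is_instance_def)
  consider
    (lost) i ys where "\<bar>i\<bar> \<le> int N" "distinct (xs @ ys)" "set ys \<subseteq> range G"
      "G (i - 1) \<in> set ys" "G (i + 1) \<in> set ys" "held A (xs @ ys) = {G i}"
  | (long) i ys where "distinct (xs @ ys)" "set ys \<subseteq> range G"
      "G ` {i..i + int N} \<subseteq> set ys"
      "(\<exists>j. held A (xs @ ys) = {G j}) \<or> held A (xs @ ys) = held A xs"
    by (rule row_walk_both_ways[of xs G N A, OF dist inj fresh nbr outer_conflict \<open>1 \<le> N\<close>])
  then show ?thesis
  proof cases
    case lost
    \<comment> \<open>The new region is the middle of \<open>G i\<close> that neither neighbour
      covers.\<close>
    define a' where "a' = c + 3 * u * of_int i + u"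
    define b' where "b' = a' + 2 * u"
    let ?S = "insert (G (i - 1)) (insert (G (i + 1)) S)"
    have new_inside: "ivl (G (i - 1)) \<subseteq> {a..<b}" "ivl (G (i + 1)) \<subseteq> {a..<b}"
      using inside lost(1) by auto
    have "{a'..<b'} \<subseteq> ivl (G i)"
      using \<open>0 < u\<close> by (auto simp: a'_def b'_def ivl_def G_def)
    moreover have "ivl (G i) \<subseteq> {a..<b}" using inside lost(1) by auto
    ultimately have region: "{a'..<b'} \<subseteq> ivl (G i)" "{a'..<b'} \<subseteq> {a..<b}"
      using subset_trans by blast+
    have gap: "ivl (G (i - 1)) \<inter> {a'..<b'} = {}" "ivl (G (i + 1)) \<inter> {a'..<b'} = {}"
      by (auto simp: a'_def b'_def ivl_def G_def algebra_simps)
    have "G (i - 1) \<noteq> G (i + 1)" using inj by (auto dest: injD)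
    moreover have "G (i - 1) \<notin> S" "G (i + 1) \<notin> S" using S(1) fresh by auto
    moreover have "finite S" using S(1) finite_subset by blast
    ultimately have "card ?S = 2 * Suc j" using S(3) by simp
    moreover have "conflict_free ?S"
    proof -
      have "\<not> conflict (G (i - 1)) (G (i + 1))" by (rule apart) simp
      moreover have "\<not> conflict (G (i - 1)) I" "\<not> conflict (G (i + 1)) I" if "I \<in> S" for I
        using S(4)[OF that] new_inside unfolding conflict_def by blast+
      ultimately show ?thesis
        using S(2) conflict_sym unfolding conflict_free_def pairwise_insert by blast
    qed
    moreover have "?S \<subseteq> set (xs @ ys)" using S(1) lost(4,5) by auto
    moreover have "ivl I \<inter> {a'..<b'} = {}" if "I \<in> ?S" for I
      using that gap S(4) region(2) by blast
    ultimately have "\<exists>S \<subseteq> set (xs @ ys). conflict_free S \<and> card S = 2 * Suc j \<and>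
        (\<forall>I \<in> S. ivl I \<inter> {a'..<b'} = {})" by blast
    moreover have "b' - a' < ivl_length I" if "I \<in> set (xs @ ys)" for I
    proof (cases "I \<in> set xs")
      case True
      have "b' - a' = 2 * u" by (simp add: b'_def)
      then show ?thesis using larger[OF True] uN \<open>b - a = _\<close> \<open>0 < u\<close> by linarith
    next
      case False
      then have "ivl_length I = 4 * u" using that lost(3) len by auto
      then show ?thesis using \<open>0 < u\<close> by (simp add: b'_def)
    qed
    moreover have "a' < b'" using \<open>0 < u\<close> by (simp add: b'_def)
    ultimately have "cornered A (Suc j) (xs @ ys) a' b'"
      unfolding cornered_def
      using inst' lens' lost(2,3) region(1) lost(6) by (simp add: ALG_def)
    then show ?thesis by blast
  next
    case long
    let ?T = "(\<lambda>m. G (i + 2 * int m)) ` {..<n}"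
    have "?T \<subseteq> set (xs @ ys)"
    proof -
      have "?T \<subseteq> G ` {i..i + int N}" by (auto simp: N_def)
      then show ?thesis using long(3) by auto
    qed
    moreover have "conflict_free ?T"
    proof -
      have "\<not> conflict (G (i + 2 * int m)) (G (i + 2 * int m'))" if "m \<noteq> m'" for m m'
      proof (cases "m < m'")
        case True
        then show ?thesis by (intro apart) linarith
      next
        case False
        then have "m' < m" using that by simp
        then have "\<not> conflict (G (i + 2 * int m')) (G (i + 2 * int m))"
          by (intro apart) linarith
        then show ?thesis using conflict_sym by blast
      qed
      then show ?thesis unfolding conflict_free_def by (intro pairwise_imageI) simp
    qed
    ultimately have "card ?T \<le> OPT (xs @ ys)" by (rule OPT_ge_card)
    moreover have "card ?T = n"
      by (subst card_image) (auto simp: inj_on_def inj_eq[OF inj])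
    moreover have "ALG A (xs @ ys) \<le> 1"
      using long(4) single by (auto simp: ALG_def)
    ultimately show ?thesis using inst' lens' long(1,2) by metis
  qed
qed

section \<open>Iterating the rounds\<close>

text \<open>Starting from no arrivals, each round ends in a hard instance or adds one length and two
  intervals to \<open>S\<close>; after \<open>k\<close> rounds \<open>S\<close> itself is large
  enough.\<close>

lemma hard_instance:
  assumes "1 \<le> k"
  shows "\<exists>xs. is_instance xs \<and> num_lengths xs \<le> k \<and> ALG A xs \<le> 1 \<and> 2 * k \<le> OPT xs"
proof -
  let ?hard = "\<exists>xs. is_instance xs \<and> num_lengths xs \<le> k \<and> ALG A xs \<le> 1 \<and> 2 * k \<le> OPT xs"
  have "(\<exists>xs a b. cornered A j xs a b) \<or> ?hard" if "j \<le> k" for j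
    using that
  proof (induction j)
    case 0
    have "cornered A 0 [] 0 1"
      by (auto simp: cornered_def is_instance_def num_lengths_def ALG_def conflict_free_def)
    then show ?case by blast
  next
    case (Suc j)
    then consider (cornered) xs a b where "cornered A j xs a b" | (hard) ?hard by auto
    then show ?case
    proof cases
      case cornered
      \<comment> \<open>Every round uses \<open>n = 2 * k\<close>, so that a long row suffices by
        itself, without the intervals of \<open>S\<close>.\<close>
      have "1 \<le> 2 * k" using assms by simp
      from cornered_step[OF cornered this] show ?thesis
        using Suc.prems le_trans by blast
    next
      case hard
      then show ?thesis by blast
    qed
  qed
  then consider (cornered) xs a b where "cornered A k xs a b" | (hard) ?hard by blast
  then show ?thesis
  proof cases
    case cornered
    then show ?thesis
      unfolding cornered_def using OPT_ge_card by metis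
  next
    case hard
    then show ?thesis .
  qed
qed

theorem theorem2:
  fixes k :: nat and A :: online_algorithm
  assumes "k \<ge> 1"
  shows "(\<exists>xs. xs \<noteq> [] \<and> is_instance xs \<and> num_lengths xs \<le> k \<and> OPT xs \<ge> 2 * k * ALG A xs) \<and>
         (\<forall>c. competitive k c A \<longrightarrow> c \<ge> 2 * real k)"
proof -
  obtain xs where xs: "is_instance xs" "num_lengths xs \<le> k" "ALG A xs \<le> 1" "2 * k \<le> OPT xs"
    using hard_instance[OF assms] by blast
  \<comment> \<open>The empty sequence satisfies the ratio inequality trivially; the absolute bound
    \<open>2 * k \<le> OPT xs\<close> excludes it.\<close>
  have "OPT [] = 0" by (simp add: OPT_def conflict_free_def)
  then have "xs \<noteq> []" using xs(4) assms by auto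
  moreover have "2 * k * ALG A xs \<le> OPT xs"
    using xs(3,4) by (cases "ALG A xs = 0") (auto simp: le_Suc_eq)
  moreover have "c \<ge> 2 * real k" if "competitive k c A" for c
  proof -
    have "real (2 * k) \<le> real (OPT xs)" using xs(4) by (rule of_nat_mono)
    also have "\<dots> \<le> c * real (ALG A xs)" using that xs(1,2) by (simp add: competitive_def)
    finally have "2 * real k \<le> c * real (ALG A xs)" by simp
    moreover have "ALG A xs = 0 \<or> ALG A xs = 1" using xs(3) by linarith
    \<comment> \<open>\<open>ALG A xs = 0\<close> would force \<open>2 * k \<le> 0\<close>, so
      exactly one interval is held and \<open>c\<close> is bounded directly.\<close>
    ultimately show ?thesis using assms by auto
  qed
  ultimately show ?thesis using xs(1,2) by blast
qed

end
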